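(* For every $n\ge 0$, the assignment sending each normal lax functor $F:[n]\to\Sigma\mathbf 2$ to the relation $$\{(i,j)\in[n]\times[n]\ :\ F(i\le j)=0\ \text{ or }\ F(j\le i)=0\}$$ (where the condition $F(i\le j)=0$ is understood to include that $i\le j$ holds, and likewise $F(j\le i)=0$ includes $j\le i$) is a bijection from the set $\mathbb{C}_n=(N\Sigma\mathbf 2)_n$ of $n$-simplices of the Catalan simplicial set to the set $\mathbb{K}_n$ of relations $R\subseteq[n]\times[n]$ that are reflexive, symmetric and have the interpolation property. Consequently $|\mathbb{C}_n|$ is the Catalan number $\frac{1}{n+2}\binom{2n+2}{n+1}$.
   Context: $[n]=\{0,1,\dots,n\}$ with its usual order, regarded as a category. $\mathbf 2$ is the ordered set $\{0\le1\}$, made a strict monoidal category with tensor product $\vee$ (disjunction) and unit $0$; $\Sigma\mathbf 2$ is the corresponding one-object 2-category (1-cells are $0,1$; composition is $\vee$; the identity 1-cell is $0$; there is a unique 2-cell $x\Rightarrow y$ iff $x\le y$). The Catalan simplicial set $\mathbb{C}=N\Sigma\mathbf 2$ is the nerve of this 2-category: its $n$-simplices are the normal lax functors $F:[n]\to\Sigma\mathbf 2$, i.e. families of elements $F(i\le j)\in\{0,1\}$, for $0\le i\le j\le n$, such that $F(i\le i)=0$ for all $i$ and $F(j\le k)\vee F(i\le j)\le F(i\le k)$ whenever $i\le j\le k$. A relation $R\subseteq[n]\times[n]$ has the interpolation property if $(i,k)\in R$ and $i\le j\le k$ imply $(i,j)\in R$ and $(j,k)\in R$. *)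

theory Defs
  imports Complex_Main "HOL-Library.FuncSet"
begin

text \<open>
  The monoidal poset \<open>2\<close> is \<open>bool\<close> with its library order: \<open>0\<close> is \<open>False\<close>, \<open>1\<close> is \<open>True\<close>, the order
  is implication, the tensor product is disjunction, and its unit is \<open>False\<close>.
  A morphism \<open>i \<le> j\<close> of \<open>[n] = {0..n}\<close> is the pair \<open>(i, j)\<close>.
\<close>

definition ordinal_arrows :: "nat \<Rightarrow> (nat \<times> nat) set" where
  "ordinal_arrows n = {(i, j). i \<le> j \<and> j \<le> n}"

text \<open>
  Normal lax functors from \<open>[n]\<close> to the suspension of \<open>2\<close>, that is, the \<open>n\<close>-simplices of its nerve.
  The target has one object and is locally posetal, so only the action on 1-cells is data.
  This action is taken extensional, so that equality of functions is equality of lax functors.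
\<close>

definition catalan_simplices :: "nat \<Rightarrow> (nat \<times> nat \<Rightarrow> bool) set" where
  "catalan_simplices n =
    {F \<in> ordinal_arrows n \<rightarrow>\<^sub>E (UNIV :: bool set).
      (\<forall>i \<le> n. F (i, i) = False) \<and>
      (\<forall>i j k. i \<le> j \<and> j \<le> k \<and> k \<le> n \<longrightarrow> (F (j, k) \<or> F (i, j)) \<le> F (i, k))}"

definition interpolation_property :: "(nat \<times> nat) set \<Rightarrow> bool" where
  "interpolation_property R \<longleftrightarrow>
    (\<forall>i j k. (i, k) \<in> R \<and> i \<le> j \<and> j \<le> k \<longrightarrow> (i, j) \<in> R \<and> (j, k) \<in> R)"

definition interpolating_relations :: "nat \<Rightarrow> (nat \<times> nat) set set" where
  "interpolating_relations n =
    {R. R \<subseteq> {0..n} \<times> {0..n} \<and> refl_on {0..n} R \<and> sym R \<and> interpolation_property R}"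

definition simplex_relation :: "nat \<Rightarrow> (nat \<times> nat \<Rightarrow> bool) \<Rightarrow> (nat \<times> nat) set" where
  "simplex_relation n F =
    {(i, j) \<in> {0..n} \<times> {0..n}. (i \<le> j \<and> F (i, j) = False) \<or> (j \<le> i \<and> F (j, i) = False)}"

end

theory Submission
  imports Defs
begin

text \<open>
  A simplex \<open>F\<close> is recovered from its relation \<open>R\<close>, because for \<open>i \<le> j\<close> one has \<open>F (i, j) = 0\<close> iff
  \<open>(i, j) \<in> R\<close>: the two disjuncts defining \<open>R\<close> can both apply only on the diagonal, where \<open>F\<close> is \<open>0\<close>.
  Read contrapositively, the lax composition law for \<open>F\<close> says that \<open>F (i, k) = 0\<close> forces
  \<open>F (i, j) = 0\<close> and \<open>F (j, k) = 0\<close>, which is interpolation for \<open>R\<close>.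

  For the count, the composition law makes \<open>{j. j \<le> i \<and> F (j, i) = 1}\<close> an initial segment
  \<open>{..<s i}\<close> that omits \<open>i\<close> and grows with \<open>i\<close>. Hence \<open>F\<close> amounts to a monotone \<open>s\<close> on
  \<open>{0..n}\<close> with \<open>s i \<le> i\<close>, in other words a lattice path that stays below the diagonal
  (\<open>bij_betw_staircase_catalan_simplices\<close>). The number of such functions on \<open>{..<m}\<close> that are
  bounded by \<open>h\<close> satisfies a Pascal recurrence, obtained by asking whether the last value attains the
  bound. For \<open>h \<le> m\<close> its solution is the ballot number
  \<open>(m + h choose m) - (m + h choose (m + 1))\<close> (\<open>card_staircase\<close>), and \<open>m = h = n + 1\<close> gives the
  Catalan number.
\<close>

section \<open>Simplices as interpolating relations\<close>

lemma catalan_simplices_iff: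
  "F \<in> catalan_simplices n \<longleftrightarrow>
    F \<in> extensional (ordinal_arrows n) \<and> (\<forall>i\<le>n. \<not> F (i, i)) \<and>
    (\<forall>i j k. i \<le> j \<longrightarrow> j \<le> k \<longrightarrow> k \<le> n \<longrightarrow> F (i, j) \<or> F (j, k) \<longrightarrow> F (i, k))"
  unfolding catalan_simplices_def by (auto simp: PiE_def le_bool_def)

lemma mem_simplex_relation_iff:
  assumes "F \<in> catalan_simplices n" "i \<le> j" "j \<le> n"
  shows "(i, j) \<in> simplex_relation n F \<longleftrightarrow> \<not> F (i, j)"
  using assms by (auto simp: simplex_relation_def)

lemma sym_simplex_relation: "sym (simplex_relation n F)"
  by (auto simp: simplex_relation_def sym_def)

lemma simplex_relation_in_interpolating_relations:
  assumes F: "F \<in> catalan_simplices n"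
  shows "simplex_relation n F \<in> interpolating_relations n"
proof -
  have sub: "simplex_relation n F \<subseteq> {0..n} \<times> {0..n}"
    by (auto simp: simplex_relation_def)
  moreover have "refl_on {0..n} (simplex_relation n F)"
    using F by (auto simp: refl_on_def simplex_relation_def catalan_simplices_iff)
  moreover have "interpolation_property (simplex_relation n F)"
    unfolding interpolation_property_def
  proof (intro allI impI, elim conjE)
    fix i j k assume R: "(i, k) \<in> simplex_relation n F" and le: "i \<le> j" "j \<le> k"
    have k: "k \<le> n" using R sub by auto
    have "\<not> F (i, k)"
      using mem_simplex_relation_iff[OF F, of i k] R le k by simp
    then have "\<not> F (i, j)" "\<not> F (j, k)"
      using F le k unfolding catalan_simplices_iff by blast+
    then show "(i, j) \<in> simplex_relation n F \<and> (j, k) \<in> simplex_relation n F"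
      using mem_simplex_relation_iff[OF F] le k by simp
  qed
  ultimately show ?thesis
    using sym_simplex_relation by (simp add: interpolating_relations_def)
qed

text \<open>The simplex whose value on \<open>i \<le> j\<close> is \<open>0\<close> exactly when \<open>(i, j)\<close> lies in the given relation.\<close>

definition relation_simplex :: "nat \<Rightarrow> (nat \<times> nat) set \<Rightarrow> nat \<times> nat \<Rightarrow> bool" where
  "relation_simplex n R = restrict (\<lambda>a. a \<notin> R) (ordinal_arrows n)"

lemma relation_simplex_in_catalan_simplices:
  assumes R: "R \<in> interpolating_relations n"
  shows "relation_simplex n R \<in> catalan_simplices n"
proof -
  have refl: "\<And>i. i \<le> n \<Longrightarrow> (i, i) \<in> R" and "interpolation_property R"
    using R by (auto simp: interpolating_relations_def refl_on_def)
  then have interp: "(i, j) \<in> R \<and> (j, k) \<in> R" if "(i, k) \<in> R" "i \<le> j" "j \<le> k" for i j k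
    using that unfolding interpolation_property_def by blast
  have val: "relation_simplex n R (i, j) \<longleftrightarrow> (i, j) \<notin> R" if "i \<le> j" "j \<le> n" for i j
    using that by (simp add: relation_simplex_def ordinal_arrows_def)
  show ?thesis
    unfolding catalan_simplices_iff
  proof (intro conjI allI impI)
    show "relation_simplex n R \<in> extensional (ordinal_arrows n)"
      by (simp add: relation_simplex_def)
  next
    fix i assume "i \<le> n"
    then show "\<not> relation_simplex n R (i, i)" using refl by (simp add: val)
  next
    fix i j k assume "i \<le> j" "j \<le> k" "k \<le> n"
      and "relation_simplex n R (i, j) \<or> relation_simplex n R (j, k)"
    then show "relation_simplex n R (i, k)" using interp[of i k j] by (auto simp: val)
  qed
qed

lemma relation_simplex_simplex_relation:
  assumes F: "F \<in> catalan_simplices n"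
  shows "relation_simplex n (simplex_relation n F) = F"
proof (rule extensionalityI[of _ "ordinal_arrows n"])
  show "F \<in> extensional (ordinal_arrows n)" using F by (simp add: catalan_simplices_iff)
  fix a assume "a \<in> ordinal_arrows n"
  then show "relation_simplex n (simplex_relation n F) a = F a"
    using mem_simplex_relation_iff[OF F]
    by (auto simp: relation_simplex_def ordinal_arrows_def)
qed (simp add: relation_simplex_def)

lemma simplex_relation_relation_simplex:
  assumes R: "R \<in> interpolating_relations n"
  shows "simplex_relation n (relation_simplex n R) = R"
proof -
  have sub: "R \<subseteq> {0..n} \<times> {0..n}" and sym: "sym R"
    using R by (auto simp: interpolating_relations_def)
  have "(i, j) \<in> simplex_relation n (relation_simplex n R) \<longleftrightarrow> (i, j) \<in> R" for i j
    using sub symD[OF sym] le_cases[of i j]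
    by (auto simp: simplex_relation_def relation_simplex_def ordinal_arrows_def)
  then show ?thesis by auto
qed

lemma bij_betw_simplex_relation:
  "bij_betw (simplex_relation n) (catalan_simplices n) (interpolating_relations n)"
  by (rule bij_betw_byWitness[where f' = "relation_simplex n"])
    (auto simp: relation_simplex_simplex_relation simplex_relation_relation_simplex
      simplex_relation_in_interpolating_relations relation_simplex_in_catalan_simplices)

section \<open>Ballot numbers\<close>

text \<open>
  Monotone functions on \<open>{..<m}\<close>, taken extensional, lying below the diagonal and below the bound
  \<open>h\<close>. The bound is kept apart from the length \<open>m\<close> so that the recurrence can vary both.
\<close>

definition staircase :: "nat \<Rightarrow> nat \<Rightarrow> (nat \<Rightarrow> nat) set" where
  "staircase m h =
    {s \<in> extensional {..<m}. mono_on {..<m} s \<and> (\<forall>i<m. s i \<le> i \<and> s i \<le> h)}"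

lemma finite_staircase: "finite (staircase m h)"
proof (rule finite_subset)
  show "staircase m h \<subseteq> {..<m} \<rightarrow>\<^sub>E {..h}"
    by (auto simp: staircase_def PiE_def)
qed (simp add: finite_PiE)

lemma staircase_0_right: "staircase m 0 = {restrict (\<lambda>i. 0) {..<m}}"
proof (intro equalityI subsetI)
  fix s assume "s \<in> staircase m 0"
  then have "s = restrict (\<lambda>i. 0) {..<m}"
    by (intro extensionalityI[of _ "{..<m}"]) (auto simp: staircase_def)
  then show "s \<in> {restrict (\<lambda>i. 0) {..<m}}" by simp
qed (auto simp: staircase_def mono_on_def)

lemma staircase_Suc_diagonal: "staircase (Suc m) (Suc m) = staircase (Suc m) m"
proof -
  have "s i \<le> i \<and> s i \<le> Suc m \<longleftrightarrow> s i \<le> i \<and> s i \<le> m" if "i < Suc m" for s :: "nat \<Rightarrow> nat" and i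
    using that by arith
  then show ?thesis by (simp add: staircase_def cong: conj_cong)
qed

lemma staircase_Suc_Suc:
  assumes "Suc h \<le> m"
  shows "staircase (Suc m) (Suc h) =
    staircase (Suc m) h \<union> (\<lambda>s. s(m := Suc h)) ` staircase m (Suc h)"
proof (intro equalityI subsetI)
  fix s assume s: "s \<in> staircase (Suc m) (Suc h)"
  have mono: "\<And>i j. i \<le> j \<Longrightarrow> j \<le> m \<Longrightarrow> s i \<le> s j"
    using s by (auto simp: staircase_def mono_on_def less_Suc_eq_le)
  show "s \<in> staircase (Suc m) h \<union> (\<lambda>s. s(m := Suc h)) ` staircase m (Suc h)"
  proof (cases "s m = Suc h")
    case True
    have "restrict s {..<m} \<in> staircase m (Suc h)"
      using s by (auto simp: staircase_def mono_on_def)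
    moreover have "s = (restrict s {..<m})(m := Suc h)"
      using s True by (auto simp: staircase_def extensional_def fun_eq_iff)
    ultimately show ?thesis by blast
  next
    case False
    then have "s m \<le> h" using s by (auto simp: staircase_def le_Suc_eq)
    then have "s i \<le> h" if "i < Suc m" for i
      using mono[of i m] that by simp
    then show ?thesis using s by (auto simp: staircase_def)
  qed
next
  fix s assume "s \<in> staircase (Suc m) h \<union> (\<lambda>s. s(m := Suc h)) ` staircase m (Suc h)"
  then show "s \<in> staircase (Suc m) (Suc h)"
    using assms by (auto simp: staircase_def mono_on_def extensional_def less_Suc_eq le_SucI)
qed

lemma card_staircase_Suc_Suc:
  assumes "Suc h \<le> m"
  shows "card (staircase (Suc m) (Suc h)) = card (staircase (Suc m) h) + card (staircase m (Suc h))"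
proof -
  have "inj_on (\<lambda>s. s(m := Suc h)) (staircase m (Suc h))"
  proof (rule inj_onI)
    fix s t assume st: "s \<in> staircase m (Suc h)" "t \<in> staircase m (Suc h)"
      and eq: "s(m := Suc h) = t(m := Suc h)"
    show "s = t"
    proof (rule extensionalityI[of _ "{..<m}"])
      fix i assume "i \<in> {..<m}"
      then show "s i = t i" using fun_cong[OF eq, of i] by simp
    qed (use st in \<open>auto simp: staircase_def\<close>)
  qed
  moreover have "staircase (Suc m) h \<inter> (\<lambda>s. s(m := Suc h)) ` staircase m (Suc h) = {}"
    by (auto simp: staircase_def)
  ultimately show ?thesis
    by (simp add: staircase_Suc_Suc[OF assms] card_Un_disjoint finite_staircase card_image)
qed

text \<open>
  The recurrence holds strictly below the diagonal \<open>h = m\<close>. On the diagonal the bound \<open>m\<close> may be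
  lowered to \<open>m - 1\<close>, and the symmetry of the binomial coefficients absorbs the change.
\<close>

lemma card_staircase:
  "h \<le> m \<Longrightarrow> card (staircase m h) + (m + h choose Suc m) = m + h choose m"
proof (induction m arbitrary: h)
  case 0
  then show ?case by (simp add: staircase_0_right)
next
  case (Suc m)
  note shorter = Suc.IH
  from Suc.prems show ?case
  proof (induction h)
    case 0
    then show ?case by (simp add: staircase_0_right)
  next
    case (Suc h)
    have IH: "card (staircase (Suc m) h) + (Suc (m + h) choose Suc (Suc m)) =
        Suc (m + h) choose Suc m"
      using Suc by simp
    show ?case
    proof (cases "h = m")
      case True
      have "Suc (m + m) choose m = Suc (m + m) choose Suc m"
        using binomial_symmetric[of m "Suc (m + m)"] by simp
      then show ?thesis
        using IH unfolding True staircase_Suc_diagonal by simp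
    next
      case False
      then have h: "Suc h \<le> m" using Suc.prems by simp
      show ?thesis
        using IH shorter[OF h] card_staircase_Suc_Suc[OF h] by simp
    qed
  qed
qed

lemma card_staircase_diagonal: "Suc m * card (staircase m m) = 2 * m choose m"
proof -
  have "Suc m * (2 * m choose Suc m) = m * (2 * m choose m)"
    using binomial_absorb_comp[of "2 * m" m] binomial_absorption[of m "2 * m"] by auto
  moreover have "card (staircase m m) + (2 * m choose Suc m) = 2 * m choose m"
    using card_staircase[of m m] by (simp add: mult_2)
  ultimately show ?thesis
    by (metis add_left_cancel add.commute add_mult_distrib2 mult_Suc)
qed

section \<open>Simplices as staircase functions\<close>

text \<open>The simplex whose value on \<open>j \<le> i\<close> is \<open>1\<close> exactly when \<open>j < s i\<close>.\<close>

definition staircase_simplex :: "nat \<Rightarrow> (nat \<Rightarrow> nat) \<Rightarrow> nat \<times> nat \<Rightarrow> bool" where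
  "staircase_simplex n s = restrict (\<lambda>(j, i). j < s i) (ordinal_arrows n)"

lemma bij_betw_staircase_catalan_simplices:
  "bij_betw (staircase_simplex n) (staircase (Suc n) (Suc n)) (catalan_simplices n)"
proof (rule bij_betwI')
  fix s t assume s: "s \<in> staircase (Suc n) (Suc n)" and t: "t \<in> staircase (Suc n) (Suc n)"
  show "staircase_simplex n s = staircase_simplex n t \<longleftrightarrow> s = t"
  proof
    assume eq: "staircase_simplex n s = staircase_simplex n t"
    show "s = t"
    proof (rule extensionalityI[of _ "{..<Suc n}"])
      fix i assume "i \<in> {..<Suc n}"
      then have i: "i \<le> n" "s i \<le> i" "t i \<le> i"
        using s t by (auto simp: staircase_def)
      have "j < s i \<longleftrightarrow> j < t i" if "j \<le> i" for j
        using fun_cong[OF eq, of "(j, i)"] that i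
        by (simp add: staircase_simplex_def ordinal_arrows_def)
      then show "s i = t i"
        using i by (metis less_irrefl linorder_neqE_nat)
    qed (use s t in \<open>auto simp: staircase_def\<close>)
  qed simp
next
  fix s assume s: "s \<in> staircase (Suc n) (Suc n)"
  then have "s i \<le> s j" if "i \<le> j" "j \<le> n" for i j
    using that by (auto simp: staircase_def mono_on_def)
  moreover have "s i \<le> i" if "i \<le> n" for i
    using s that by (auto simp: staircase_def)
  ultimately show "staircase_simplex n s \<in> catalan_simplices n"
    unfolding catalan_simplices_iff staircase_simplex_def
    by (fastforce simp: ordinal_arrows_def)
next
  fix F assume F: "F \<in> catalan_simplices n"
  have diag: "\<And>i. i \<le> n \<Longrightarrow> \<not> F (i, i)"
    and comp: "\<And>i j k. i \<le> j \<Longrightarrow> j \<le> k \<Longrightarrow> k \<le> n \<Longrightarrow> F (i, j) \<or> F (j, k) \<Longrightarrow> F (i, k)"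
    using F unfolding catalan_simplices_iff by blast+
  define s where "s = restrict (\<lambda>i. LEAST j. \<not> F (j, i)) {..<Suc n}"
  have s_ext: "s \<in> extensional {..<Suc n}" by (simp add: s_def)
  have s_le: "s i \<le> j" if "i \<le> n" "\<not> F (j, i)" for i j
    using that by (auto simp: s_def intro: Least_le)
  have not_s: "\<not> F (s i, i)" if "i \<le> n" for i
    using that LeastI[of "\<lambda>j. \<not> F (j, i)" i] diag[of i] by (simp add: s_def)
  \<comment> \<open>The arrows into \<open>i\<close> of value \<open>1\<close> start at an initial segment, so the least exception decides.\<close>
  have F_iff: "F (j, i) \<longleftrightarrow> j < s i" if "j \<le> i" "i \<le> n" for i j
  proof
    assume "F (j, i)"
    then show "j < s i"
      using comp[of "s i" j i] not_s that by (meson not_le)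
  next
    assume "j < s i"
    then show "F (j, i)" using s_le that by (meson not_le)
  qed
  have below: "s i \<le> i" if "i \<le> n" for i
    using s_le diag that by blast
  have "mono_on {..<Suc n} s"
  proof (rule mono_onI)
    fix i j assume "i \<in> {..<Suc n}" "j \<in> {..<Suc n}" "i \<le> j"
    then have ij: "i \<le> j" "j \<le> n" by auto
    show "s i \<le> s j"
    proof (rule ccontr)
      assume lt: "\<not> s i \<le> s j"
      then have "F (s j, i)" using F_iff[of "s j" i] below[of i] ij by simp
      then have "F (s j, j)" using comp[of "s j" i j] below[of i] lt ij by simp
      then show False using not_s ij by blast
    qed
  qed
  then have "s \<in> staircase (Suc n) (Suc n)"
    using below s_ext by (auto simp: staircase_def less_Suc_eq_le intro: le_trans le_SucI)
  moreover have "F = staircase_simplex n s"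
  proof (rule extensionalityI[of _ "ordinal_arrows n"])
    show "F \<in> extensional (ordinal_arrows n)" using F by (simp add: catalan_simplices_iff)
    fix a assume "a \<in> ordinal_arrows n"
    then show "F a = staircase_simplex n s a"
      using F_iff by (auto simp: staircase_simplex_def ordinal_arrows_def)
  qed (simp add: staircase_simplex_def)
  ultimately show "\<exists>s\<in>staircase (Suc n) (Suc n). F = staircase_simplex n s" by blast
qed

theorem proposition4p1:
  fixes n :: nat
  shows "bij_betw (simplex_relation n) (catalan_simplices n) (interpolating_relations n) \<and>
    real (card (catalan_simplices n)) = 1 / (real n + 2) * real ((2 * n + 2) choose (n + 1))"
proof
  have "card (catalan_simplices n) = card (staircase (Suc n) (Suc n))"
    using bij_betw_same_card[OF bij_betw_staircase_catalan_simplices] by simp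
  then have "(n + 2) * card (catalan_simplices n) = (2 * n + 2) choose (n + 1)"
    using card_staircase_diagonal[of "Suc n"] by simp
  then have "(real n + 2) * real (card (catalan_simplices n)) = real ((2 * n + 2) choose (n + 1))"
    by (metis of_nat_add of_nat_mult of_nat_numeral)
  then show "real (card (catalan_simplices n)) =
      1 / (real n + 2) * real ((2 * n + 2) choose (n + 1))"
    by (simp add: field_simps)
qed (rule bij_betw_simplex_relation)

end
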